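(* Let $\mathcal{X}$ be a set, $\vphantom{x}x_1,\dots,x_N\in\mathcal{X}$ a dataset, and $k:\mathcal{X}\times\mathcal{X}\to\mathbb{R}$ a kernel function with reproducing kernel Hilbert space $\mathcal{H}$ and feature map $\Phi:\mathcal{X}\to\mathcal{H}$, $\Phi(x)=k(x,\cdot)$. Let $\mathcal{W}$ be the space of linear maps $W:\mathcal{H}\to\mathbb{R}^K$ (as described in the context), let $\mathcal{R}:(\mathbb{R}^K)^N\to\mathbb{R}$ be any risk function, and let $r:[0,\infty)\to\mathbb{R}$ be any strictly increasing function. Let $W^*$ be any solution of $$W^*\in\operatorname*{arg\,min}_{W\in\mathcal{W}}\ \mathcal{R}\big(W\Phi(x_1),\dots,W\Phi(x_N)\big)+r\big(\|W\|_{\mathcal{H}}\big).$$ Then there is a matrix $M\in\mathbb{R}^{K\times N}$ such that for all $x,x'\in\mathcal{X}$, $$W^*\Phi(x)=M\,k_{X,x},\qquad k^*(x,x')=\big(Mk_{X,x}\big)^{\top}Mk_{X,x'}=k_{X,x}^{\top}M^{\top}M\,k_{X,x'},$$ where $k_{X,x}\in\mathbb{R}^N$ is the vector with entries $[k_{X,x}]_i=k(x_i,x)$ and $k^*(x,x'):=\langle W^*\Phi(x),W^*\Phi(x')\rangle_{\mathbb{R}^K}$ is the induced kernel.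
   Context: A linear map $W\in\mathcal{W}$ is given by components $W_1,\dots,W_K\in\mathcal{H}$ via $W\phi=(\langle W_1,\phi\rangle_{\mathcal{H}},\dots,\langle W_K,\phi\rangle_{\mathcal{H}})$ for $\phi\in\mathcal{H}$. Its RKHS norm is $\|W\|_{\mathcal{H}}=\sqrt{\sum_{i=1}^K\langle W_i,W_i\rangle_{\mathcal{H}}}$. The kernel $k$ is real, symmetric and positive semi-definite. The induced kernel of $W^*$ is the inner product of the output representations $W^*\Phi(x)$. *)

theory Defs
  imports "HOL-Analysis.Analysis"
begin

definition psd_kernel :: "'a set \<Rightarrow> ('a \<Rightarrow> 'a \<Rightarrow> real) \<Rightarrow> bool" where
  "psd_kernel X k \<longleftrightarrow>
     (\<forall>x\<in>X. \<forall>y\<in>X. k x y = k y x) \<and>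
     (\<forall>(n::nat) (p :: nat \<Rightarrow> 'a) (c :: nat \<Rightarrow> real). (\<forall>i<n. p i \<in> X) \<longrightarrow>
        (\<Sum>i<n. \<Sum>j<n. c i * c j * k (p i) (p j)) \<ge> 0)"

text \<open>A real function on the set \<open>X\<close> is represented by a function on the whole type that
  vanishes outside \<open>X\<close>, so that equality of functions on \<open>X\<close> is equality in HOL.
  In particular \<open>k(x,\<cdot>)\<close> is cut off outside \<open>X\<close>.\<close>

definition feature_map :: "'a set \<Rightarrow> ('a \<Rightarrow> 'a \<Rightarrow> real) \<Rightarrow> 'a \<Rightarrow> ('a \<Rightarrow> real)" where
  "feature_map X k x = (\<lambda>y. if y \<in> X then k x y else 0)"

text \<open>\<open>H\<close> with inner product \<open>ip\<close> is a reproducing kernel Hilbert space of \<open>k\<close> on \<open>X\<close>: a Hilbert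
  space of functions on \<open>X\<close>, with pointwise operations, that contains every \<open>k(x,\<cdot>)\<close> and has the
  reproducing property. These conditions determine \<open>H\<close> and the values of \<open>ip\<close> on \<open>H\<close>;
  the values of \<open>ip\<close> outside \<open>H\<close> are irrelevant.\<close>

locale rkhs =
  fixes X :: "'a set"
    and k :: "'a \<Rightarrow> 'a \<Rightarrow> real"
    and H :: "('a \<Rightarrow> real) set"
    and ip :: "('a \<Rightarrow> real) \<Rightarrow> ('a \<Rightarrow> real) \<Rightarrow> real"
  assumes vanish: "f \<in> H \<Longrightarrow> x \<notin> X \<Longrightarrow> f x = 0"
    and zero_mem: "(\<lambda>x. 0) \<in> H"
    and add_mem: "f \<in> H \<Longrightarrow> g \<in> H \<Longrightarrow> (\<lambda>x. f x + g x) \<in> H"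
    and scale_mem: "f \<in> H \<Longrightarrow> (\<lambda>x. c * f x) \<in> H"
    and ip_commute: "f \<in> H \<Longrightarrow> g \<in> H \<Longrightarrow> ip f g = ip g f"
    and ip_add: "f \<in> H \<Longrightarrow> g \<in> H \<Longrightarrow> h \<in> H \<Longrightarrow> ip (\<lambda>x. f x + g x) h = ip f h + ip g h"
    and ip_scale: "f \<in> H \<Longrightarrow> g \<in> H \<Longrightarrow> ip (\<lambda>x. c * f x) g = c * ip f g"
    and ip_nonneg: "f \<in> H \<Longrightarrow> ip f f \<ge> 0"
    and ip_eq_zero: "f \<in> H \<Longrightarrow> ip f f = 0 \<Longrightarrow> f = (\<lambda>x. 0)"
    and complete:
      "\<lbrakk> \<And>n::nat. F n \<in> H;
         \<And>e. e > 0 \<Longrightarrow> \<exists>n0. \<forall>m\<ge>n0. \<forall>n\<ge>n0.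
           sqrt (ip (\<lambda>x. F m x - F n x) (\<lambda>x. F m x - F n x)) < e \<rbrakk> \<Longrightarrow>
       \<exists>f\<in>H. (\<lambda>n. sqrt (ip (\<lambda>x. F n x - f x) (\<lambda>x. F n x - f x))) \<longlonglongrightarrow> 0"
    and feature_mem: "x \<in> X \<Longrightarrow> feature_map X k x \<in> H"
    and reproducing: "f \<in> H \<Longrightarrow> x \<in> X \<Longrightarrow> ip f (feature_map X k x) = f x"

text \<open>A linear map \<open>W\<close> from \<open>H\<close> to \<open>\<real>\<^sup>K\<close> is represented by its vector of components in \<open>H\<close>.\<close>

definition linear_maps :: "('a \<Rightarrow> real) set \<Rightarrow> (('a \<Rightarrow> real) ^ 'k) set" where
  "linear_maps H = {W. \<forall>i. W $ i \<in> H}"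

definition app ::
  "(('a \<Rightarrow> real) \<Rightarrow> ('a \<Rightarrow> real) \<Rightarrow> real) \<Rightarrow> ('a \<Rightarrow> real) ^ 'k \<Rightarrow> ('a \<Rightarrow> real) \<Rightarrow> real ^ 'k" where
  "app ip W \<phi> = (\<chi> i. ip (W $ i) \<phi>)"

definition rkhs_norm ::
  "(('a \<Rightarrow> real) \<Rightarrow> ('a \<Rightarrow> real) \<Rightarrow> real) \<Rightarrow> ('a \<Rightarrow> real) ^ 'k \<Rightarrow> real" where
  "rkhs_norm ip W = sqrt (\<Sum>i\<in>UNIV. ip (W $ i) (W $ i))"

definition induced_kernel ::
  "'a set \<Rightarrow> ('a \<Rightarrow> 'a \<Rightarrow> real) \<Rightarrow> (('a \<Rightarrow> real) \<Rightarrow> ('a \<Rightarrow> real) \<Rightarrow> real) \<Rightarrow>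
   ('a \<Rightarrow> real) ^ 'k \<Rightarrow> 'a \<Rightarrow> 'a \<Rightarrow> real" where
  "induced_kernel X k ip W x x' =
     app ip W (feature_map X k x) \<bullet> app ip W (feature_map X k x')"

definition kernel_vec :: "('a \<Rightarrow> 'a \<Rightarrow> real) \<Rightarrow> 'a ^ 'n \<Rightarrow> 'a \<Rightarrow> real ^ 'n" where
  "kernel_vec k xs x = (\<chi> i. k (xs $ i) x)"

end

theory Submission
  imports Defs
begin

text \<open>Split each component of \<open>W\<^sup>*\<close> into its orthogonal projection onto the span of the
  features of the data and a remainder orthogonal to them. By the reproducing property the
  remainder vanishes at the data points, so dropping it leaves the risk unchanged, while by
  Pythagoras it strictly decreases the norm unless the remainder is zero. Hence every component
  of a minimizer is a combination of the functions \<open>k(x\<^sub>j, \<cdot>)\<close>, whose coefficients form a row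
  of \<open>M\<close>.\<close>

context rkhs
begin

lemma sum_mem:
  assumes "finite J" "\<And>j. j \<in> J \<Longrightarrow> v j \<in> H"
  shows "(\<lambda>x. \<Sum>j\<in>J. c j * v j x) \<in> H"
  using assms by (induction J) (auto intro!: zero_mem add_mem scale_mem)

lemma diff_mem:
  assumes "f \<in> H" "g \<in> H"
  shows "(\<lambda>x. f x - g x) \<in> H"
  using add_mem[OF assms(1) scale_mem[OF assms(2), of "-1"]] by simp

lemma ip_diff:
  assumes "f \<in> H" "g \<in> H" "h \<in> H"
  shows "ip (\<lambda>x. f x - g x) h = ip f h - ip g h"
  using ip_add[OF assms(1) scale_mem[OF assms(2), of "-1"] assms(3)]
    ip_scale[OF assms(2,3), of "-1"] by simp

lemma ip_zero:
  assumes "h \<in> H"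
  shows "ip (\<lambda>x. 0) h = 0"
  using ip_scale[OF zero_mem assms, of 0] by simp

lemma ip_sum:
  assumes "finite J" "\<And>j. j \<in> J \<Longrightarrow> v j \<in> H" "h \<in> H"
  shows "ip (\<lambda>x. \<Sum>j\<in>J. c j * v j x) h = (\<Sum>j\<in>J. c j * ip (v j) h)"
  using assms by (induction J) (simp_all add: ip_zero ip_add ip_scale scale_mem sum_mem)

lemma ip_sum_eq_zero:
  assumes "finite J" "\<And>j. j \<in> J \<Longrightarrow> v j \<in> H" "h \<in> H" "\<And>j. j \<in> J \<Longrightarrow> ip h (v j) = 0"
  shows "ip (\<lambda>x. \<Sum>j\<in>J. c j * v j x) h = 0"
  using assms by (simp add: ip_sum ip_commute[of _ h])

text \<open>Induction by a Gram--Schmidt step: the new vector enters through its own remainder \<open>w\<close>.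
  If \<open>w = 0\<close>, the coefficient \<open>t\<close> is \<open>0\<close> by the convention on division.\<close>

lemma finite_span_decomposition:
  assumes "finite J" "\<And>j. j \<in> J \<Longrightarrow> v j \<in> H" "f \<in> H"
  obtains c u where "u \<in> H" "f = (\<lambda>x. (\<Sum>j\<in>J. c j * v j x) + u x)"
    "\<And>j. j \<in> J \<Longrightarrow> ip u (v j) = 0"
proof -
  have "\<exists>c u. u \<in> H \<and> f = (\<lambda>x. (\<Sum>j\<in>J. c j * v j x) + u x) \<and> (\<forall>j\<in>J. ip u (v j) = 0)"
    using assms
  proof (induction J arbitrary: f)
    case empty
    then show ?case by auto
  next
    case (insert a J)
    have vJ: "v j \<in> H" if "j \<in> J" for j
      using insert.prems(1) that by simp
    have va: "v a \<in> H"
      using insert.prems(1) by simp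
    obtain c u where u: "u \<in> H" "f = (\<lambda>x. (\<Sum>j\<in>J. c j * v j x) + u x)"
        "\<And>j. j \<in> J \<Longrightarrow> ip u (v j) = 0"
      using insert.IH[OF vJ insert.prems(2)] by blast
    \<comment> \<open>The induction hypothesis serves a second time, now for \<open>v a\<close>
      itself; this is why \<open>f\<close> is arbitrary in the induction.\<close>
    obtain d w where w: "w \<in> H" "v a = (\<lambda>x. (\<Sum>j\<in>J. d j * v j x) + w x)"
        "\<And>j. j \<in> J \<Longrightarrow> ip w (v j) = 0"
      using insert.IH[OF vJ va] by blast
    \<comment> \<open>The Gram-Schmidt coefficient: it makes \<open>u - t w\<close> orthogonal to
      \<open>w\<close>.\<close>
    define t where "t = ip u w / ip w w"
    define u' where "u' = (\<lambda>x. u x - t * w x)"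
    have u': "u' \<in> H"
      unfolding u'_def by (intro diff_mem u(1) scale_mem w(1))
    have ip_u': "ip u' h = ip u h - t * ip w h" if "h \<in> H" for h
      unfolding u'_def using that u(1) w(1) by (simp add: ip_diff ip_scale scale_mem)
    have orth_J: "ip u' (v j) = 0" if "j \<in> J" for j
      using that u(3) w(3) vJ by (simp add: ip_u')
    \<comment> \<open>The quotient \<open>t\<close> cancels only against a nonzero
      \<open>ip w w\<close>; otherwise \<open>w\<close> is the zero function and
      \<open>ip u w\<close> vanishes by itself.\<close>
    have "ip u w = 0" if "ip w w = 0"
      using ip_eq_zero[OF w(1) that] ip_zero[OF u(1)] ip_commute[OF u(1) w(1)] by simp
    then have orth_w: "ip u' w = 0"
      by (cases "ip w w = 0") (simp_all add: ip_u'[OF w(1)] t_def)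
    have "ip (v a) u' = ip (\<lambda>x. \<Sum>j\<in>J. d j * v j x) u' + ip w u'"
      by (subst w(2), rule ip_add) (use insert.hyps vJ w(1) u' sum_mem in auto)
    also have "\<dots> = 0"
      using ip_sum_eq_zero[OF insert.hyps(1) vJ u' orth_J] orth_w ip_commute[OF u' w(1)] by simp
    finally have orth_a: "ip u' (v a) = 0"
      using ip_commute[OF u' va] by simp
    \<comment> \<open>These coefficients come from putting
      \<open>w = v a - (\<Sum>j\<in>J. d j * v j)\<close> into \<open>u = u' + t w\<close>.\<close>
    let ?e = "\<lambda>j. if j = a then t else c j - t * d j"
    have "f x = (\<Sum>j\<in>insert a J. ?e j * v j x) + u' x" for x
    proof -
      have "(\<Sum>j\<in>J. ?e j * v j x) = (\<Sum>j\<in>J. c j * v j x - t * (d j * v j x))"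
        using insert.hyps(2) by (intro sum.cong) (auto simp: algebra_simps)
      also have "\<dots> = (\<Sum>j\<in>J. c j * v j x) - t * (\<Sum>j\<in>J. d j * v j x)"
        by (simp add: sum_subtractf sum_distrib_left)
      finally show ?thesis
        using insert.hyps fun_cong[OF u(2), of x] fun_cong[OF w(2), of x]
        by (simp add: u'_def algebra_simps)
    qed
    then have "f = (\<lambda>x. (\<Sum>j\<in>insert a J. ?e j * v j x) + u' x)"
      by blast
    then show ?case
      using u' orth_J orth_a by (intro exI[of _ ?e] exI[of _ u']) simp
  qed
  then show ?thesis
    using that by blast
qed

text \<open>Pythagoras. Additivity is given in the first argument only, so symmetry is used to
  expand the second.\<close>

lemma ip_add_self_orthogonal:
  assumes "f \<in> H" "g \<in> H" "ip f g = 0"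
  shows "ip (\<lambda>x. f x + g x) (\<lambda>x. f x + g x) = ip f f + ip g g"
proof -
  let ?h = "\<lambda>x. f x + g x"
  have h: "?h \<in> H"
    using assms add_mem by blast
  have "ip f ?h = ip f f" "ip g ?h = ip g g"
    using assms ip_commute[OF _ h] ip_commute[OF assms(1,2)] by (simp_all add: ip_add)
  then show ?thesis
    using ip_add[OF assms(1,2) h] by simp
qed

end

theorem proposition3p1:
  fixes X :: "'a set"
    and xs :: "'a ^ 'n"
    and k :: "'a \<Rightarrow> 'a \<Rightarrow> real"
    and H :: "('a \<Rightarrow> real) set"
    and ip :: "('a \<Rightarrow> real) \<Rightarrow> ('a \<Rightarrow> real) \<Rightarrow> real"
    and R :: "(real ^ 'k) ^ 'n \<Rightarrow> real"
    and r :: "real \<Rightarrow> real"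
    and Wstar :: "('a \<Rightarrow> real) ^ 'k"
  assumes data: "\<And>i. xs $ i \<in> X"
    and kernel: "psd_kernel X k"
    and rkhs: "rkhs X k H ip"
    and r_mono: "strict_mono_on {0..} r"
    and minimizer:
      "is_arg_min
         (\<lambda>W. R (\<chi> i. app ip W (feature_map X k (xs $ i))) + r (rkhs_norm ip W))
         (\<lambda>W. W \<in> linear_maps H) Wstar"
  shows "\<exists>M :: real ^ 'n ^ 'k. \<forall>x\<in>X. \<forall>x'\<in>X.
           app ip Wstar (feature_map X k x) = M *v kernel_vec k xs x \<and>
           induced_kernel X k ip Wstar x x'
             = (M *v kernel_vec k xs x) \<bullet> (M *v kernel_vec k xs x') \<and>
           induced_kernel X k ip Wstar x x'
             = kernel_vec k xs x \<bullet> ((transpose M ** M) *v kernel_vec k xs x')"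
proof -
  interpret rkhs X k H ip
    by (rule rkhs)
  define v where "v j = feature_map X k (xs $ j)" for j
  have v: "v j \<in> H" for j
    unfolding v_def using data feature_mem by blast
  have W_mem: "Wstar $ i \<in> H" for i
    using minimizer by (simp add: is_arg_min_def linear_maps_def)
  have "\<exists>c u. u \<in> H \<and> Wstar $ i = (\<lambda>x. (\<Sum>j\<in>UNIV. c j * v j x) + u x) \<and> (\<forall>j. ip u (v j) = 0)"
    for i
    using finite_span_decomposition[of "UNIV :: 'n set" v "Wstar $ i"] v W_mem
    by (metis UNIV_I finite_class.finite_UNIV)
  then obtain c u where u: "\<And>i. u i \<in> H"
    and W_eq: "\<And>i. Wstar $ i = (\<lambda>x. (\<Sum>j\<in>UNIV. c i j * v j x) + u i x)"
    and orth: "\<And>i j. ip (u i) (v j) = 0"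
    by metis
  define s where "s i = (\<lambda>x. \<Sum>j\<in>UNIV. c i j * v j x)" for i
  have s: "s i \<in> H" for i
    unfolding s_def by (rule sum_mem) (simp_all add: v)
  have W_s: "Wstar $ i = (\<lambda>x. s i x + u i x)" for i
    using W_eq s_def by simp
  have "ip (s i) (u i) = 0" for i
    unfolding s_def by (rule ip_sum_eq_zero) (simp_all add: u v orth)
  then have pythagoras: "ip (Wstar $ i) (Wstar $ i) = ip (s i) (s i) + ip (u i) (u i)" for i
    unfolding W_s by (rule ip_add_self_orthogonal[OF s u])
  \<comment> \<open>The competitor to the minimizer: all components are projected at once.\<close>
  define V where "V = (\<chi> i. s i)"
  have V_mem: "V \<in> linear_maps H"
    by (simp add: V_def linear_maps_def s)
  have "ip (s i) (v j) = ip (Wstar $ i) (v j)" for i j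
    by (simp add: W_s ip_add[OF s u v] orth)
  then have same_risk: "app ip V (feature_map X k (xs $ j)) = app ip Wstar (feature_map X k (xs $ j))"
    for j
    by (simp add: app_def V_def v_def)
  have u_zero: "u i x = 0" for i x
  proof (rule ccontr)
    assume "u i x \<noteq> 0"
    then have "ip (u i) (u i) > 0"
      using ip_eq_zero[OF u, of i] ip_nonneg[OF u, of i] by force
    \<comment> \<open>A single nonzero remainder makes the inequality strict, since the other
      remainders contribute nonnegative amounts.\<close>
    then have "(\<Sum>i\<in>UNIV. ip (V $ i) (V $ i)) < (\<Sum>i\<in>UNIV. ip (Wstar $ i) (Wstar $ i))"
      by (intro sum_strict_mono_ex1) (auto simp: V_def pythagoras ip_nonneg[OF u])
    then have "rkhs_norm ip V < rkhs_norm ip Wstar"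
      by (simp add: rkhs_norm_def)
    \<comment> \<open>Strict monotonicity of \<open>r\<close> is assumed on \<open>{0..}\<close>
      only, so both norms must lie there.\<close>
    moreover have "0 \<le> rkhs_norm ip V" "0 \<le> rkhs_norm ip Wstar"
      by (auto simp: rkhs_norm_def V_def intro!: sum_nonneg ip_nonneg s W_mem)
    ultimately have "r (rkhs_norm ip V) < r (rkhs_norm ip Wstar)"
      using r_mono by (auto simp: strict_mono_on_def)
    then show False
      using minimizer V_mem same_risk by (auto simp: is_arg_min_def)
  qed
  define M :: "real ^ 'n ^ 'k" where "M = (\<chi> i j. c i j)"
  have app_eq: "app ip Wstar (feature_map X k x) = M *v kernel_vec k xs x" if "x \<in> X" for x
  proof -
    \<comment> \<open>The reproducing property turns the left side into the value of
      \<open>Wstar $ i\<close> at \<open>x\<close>. It has to be applied before \<open>W_eq\<close>,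
      which would rewrite the inner product that it matches.\<close>
    have "ip (Wstar $ i) (feature_map X k x) = (\<Sum>j\<in>UNIV. c i j * k (xs $ j) x)" for i
      using that by (simp only: reproducing[OF W_mem that])
        (simp add: W_eq u_zero v_def feature_map_def)
    then show ?thesis
      by (simp add: vec_eq_iff app_def M_def matrix_vector_mult_def kernel_vec_def)
  qed
  \<comment> \<open>Adjointness: \<open>M *v y\<close> is \<open>y v* transpose M\<close>, so
    \<open>M\<close> moves across the inner product as its transpose.\<close>
  have "(M *v y) \<bullet> (M *v z) = y \<bullet> ((transpose M ** M) *v z)" for y z
    using dot_lmul_matrix[of y "transpose M" "M *v z"]
    by (simp only: vector_transpose_matrix matrix_vector_mul_assoc)
  then show ?thesis
    by (intro exI[of _ M] ballI) (simp add: induced_kernel_def app_eq)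
qed

end
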